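(* Let $\mathbb{K}$ be an algebraically closed field, $V$ a $\mathbb{K}$-vector space of finite positive dimension, and $\Phi=(A;\{E_i\}_{i=0}^d;A^*;\{E_i^*\}_{i=0}^d)$ a TD system on $V$ of diameter $d\geq 1$ that has $q$-Racah type, with fixed associated scalars $q,a,b$. Let $\Delta\in\mathrm{End}(V)$ and the subspaces $W_i$ be as defined in the context. Then for $0\leq i\leq d$, $$(\Delta-I)W_i\subseteq W_0+W_1+\cdots +W_{i-1},$$ $$(\Delta^{-1}-I)W_i\subseteq W_0+W_1+\cdots +W_{i-1}.$$
   Context: TD pair: an ordered pair of linear maps $A,A^*:V\to V$ such that (i) each is diagonalizable; (ii) there is an ordering $\{V_i\}_{i=0}^d$ of the eigenspaces of $A$ with $A^*V_i\subseteq V_{i-1}+V_i+V_{i+1}$ for $0\le i\le d$ ($V_{-1}=V_{d+1}=0$); (iii) there is an ordering $\{V_i^*\}_{i=0}^\delta$ of the eigenspaces of $A^*$ with $AV_i^*\subseteq V_{i-1}^*+V_i^*+V_{i+1}^*$ for $0\le i\le\delta$ ($V^*_{-1}=V^*_{\delta+1}=0$); (iv) no subspace $W$ with $0\ne W\ne V$ satisfies $AW\subseteq W$ and $A^*W\subseteq W$. It is known that $d=\delta$; $d$ is called the diameter. Orderings as in (ii), (iii) are called standard. The primitive idempotent of $A$ for an eigenspace $V_i$ is the projection of $V$ onto $V_i$ that vanishes on the other eigenspaces (similarly for $A^*$). TD system: $(A;\{E_i\}_{i=0}^d;A^*;\{E_i^*\}_{i=0}^d)$ where $A,A^*$ is a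 TD pair and $\{E_i\}$, $\{E_i^*\}$ are the primitive idempotents of $A$, $A^*$, in orders for which the corresponding eigenspace orderings $\{E_iV\}$, $\{E_i^*V\}$ are standard. Let $\theta_i$ (resp. $\theta_i^*$) be the eigenvalue of $A$ on $E_iV$ (resp. of $A^*$ on $E_i^*V$). $\Phi$ has $q$-Racah type if there are nonzero $q,a,b\in\mathbb{K}$ with $q^4\ne1$ and $\theta_i=aq^{d-2i}+a^{-1}q^{2i-d}$, $\theta_i^*=bq^{d-2i}+b^{-1}q^{2i-d}$ for $0\le i\le d$. (Distinctness of eigenvalues forces $q^{2i}\neq1$ for $1\le i\le d$, and $a^2\ne q^{2d-2},q^{2d-4},\dots,q^{2-2d}$; in particular $a^2\neq 1$.) Split decompositions: $U_i=(E_0^*V+\cdots+E_i^*V)\cap(E_iV+\cdots+E_dV)$ and $U_i^\Downarrow=(E_0^*V+\cdots+E_i^*V)\cap(E_0V+\cdots+E_{d-i}V)$ for $0\le i\le d$. It is known that $V=\bigoplus_i U_i=\bigoplus_i U_i^\Downarrow$ with all summands nonzero. $K,B\in\mathrm{End}(V)$ are the linear maps acting on $U_i$, respectively $U_i^\Downarrow$, as the scalar $q^{d-2i}$ ($0\le i\le d$). $\Delta\in\mathrm{End}(V)$: the unique (known to exist, and known to be invertible) linear map with $\Delta U_i\subseteq U_i^\Downarrow$ and $(\Delta-I)U_i\subseteq U_0+\cdots+U_{i-1}$ for $0\le i\le d$. $\mathcal{M}=\dfrac{aK-a^{-1}B}{a-a^{-1}}\in\mathrm{End}(V)$, and $W_i=\{v\in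 V:\mathcal{M}v=q^{d-2i}v\}$ is the eigenspace of $\mathcal{M}$ for the eigenvalue $q^{d-2i}$ ($0\le i\le d$). Empty sums of subspaces are $0$. *)

theory Defs
  imports
    "HOL-Library.Set_Algebras"
    "HOL-Computational_Algebra.Polynomial"
begin

text \<open>
  The vector space is the whole type \<open>'v\<close>, with scalar multiplication \<open>scale\<close>. Sums of
  subspaces are the elementwise sums of sets; in particular the empty sum of subspaces
  is \<open>{0}\<close>. Families indexed by \<open>0, \<dots>, d\<close> are functions on \<open>nat\<close> of which only
  the values on \<open>{..d}\<close> matter.
\<close>

definition eigenspace ::
  "('k::field \<Rightarrow> 'v::ab_group_add \<Rightarrow> 'v) \<Rightarrow>
   ('v \<Rightarrow> 'v) \<Rightarrow> 'k \<Rightarrow> 'v set" where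
  "eigenspace scale A t = {v. A v = scale t v}"

definition eigenspaces ::
  "('k::field \<Rightarrow> 'v::ab_group_add \<Rightarrow> 'v) \<Rightarrow>
   ('v \<Rightarrow> 'v) \<Rightarrow> 'v set set" where
  "eigenspaces scale A = {eigenspace scale A t | t. eigenspace scale A t \<noteq> {0}}"

definition diagonalizable ::
  "('k::field \<Rightarrow> 'v::ab_group_add \<Rightarrow> 'v) \<Rightarrow>
   ('v \<Rightarrow> 'v) \<Rightarrow> bool" where
  "diagonalizable scale A \<longleftrightarrow> module.span scale (\<Union> (eigenspaces scale A)) = UNIV"

text \<open>
  \<open>standard_ordering scale A B d V\<close>: \<open>V 0, \<dots>, V d\<close> lists the eigenspaces of \<open>A\<close>
  without repetition, and \<open>B\<close> maps \<open>V i\<close> into \<open>V (i-1) + V i + V (i+1)\<close>. The intersection with \<open>{..d}\<close> (and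
  truncated subtraction at \<open>i = 0\<close>) drops the terms \<open>V (-1)\<close> and \<open>V (d+1)\<close>, which are zero by
  convention.
\<close>
definition standard_ordering ::
  "('k::field \<Rightarrow> 'v::ab_group_add \<Rightarrow> 'v) \<Rightarrow>
   ('v \<Rightarrow> 'v) \<Rightarrow> ('v \<Rightarrow> 'v) \<Rightarrow> nat \<Rightarrow> (nat \<Rightarrow> 'v set) \<Rightarrow> bool" where
  "standard_ordering scale A B d V \<longleftrightarrow>
     bij_betw V {..d} (eigenspaces scale A) \<and>
     (\<forall>i\<le>d. B ` V i \<subseteq> (\<Sum>j\<in>{i-1..i+1} \<inter> {..d}. V j))"

definition TD_pair ::
  "('k::field \<Rightarrow> 'v::ab_group_add \<Rightarrow> 'v) \<Rightarrow>
   ('v \<Rightarrow> 'v) \<Rightarrow> ('v \<Rightarrow> 'v) \<Rightarrow> bool" where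
  "TD_pair scale A As \<longleftrightarrow>
     Vector_Spaces.linear scale scale A \<and> Vector_Spaces.linear scale scale As \<and>
     diagonalizable scale A \<and> diagonalizable scale As \<and>
     (\<exists>d V. standard_ordering scale A As d V) \<and>
     (\<exists>\<delta> Vs. standard_ordering scale As A \<delta> Vs) \<and>
     \<not> (\<exists>W. module.subspace scale W \<and> W \<noteq> {0} \<and> W \<noteq> UNIV \<and> A ` W \<subseteq> W \<and> As ` W \<subseteq> W)"

definition primitive_idempotent ::
  "('k::field \<Rightarrow> 'v::ab_group_add \<Rightarrow> 'v) \<Rightarrow>
   ('v \<Rightarrow> 'v) \<Rightarrow> 'v set \<Rightarrow> ('v \<Rightarrow> 'v) \<Rightarrow> bool" where
  "primitive_idempotent scale A U P \<longleftrightarrow>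
     U \<in> eigenspaces scale A \<and> Vector_Spaces.linear scale scale P \<and>
     range P = U \<and> (\<forall>u\<in>U. P u = u) \<and>
     (\<forall>U'\<in>eigenspaces scale A - {U}. \<forall>v\<in>U'. P v = 0)"

definition TD_system ::
  "('k::field \<Rightarrow> 'v::ab_group_add \<Rightarrow> 'v) \<Rightarrow>
   nat \<Rightarrow> ('v \<Rightarrow> 'v) \<Rightarrow> (nat \<Rightarrow> 'v \<Rightarrow> 'v) \<Rightarrow> ('v \<Rightarrow> 'v) \<Rightarrow> (nat \<Rightarrow> 'v \<Rightarrow> 'v) \<Rightarrow> bool" where
  "TD_system scale d A E As Es \<longleftrightarrow>
     TD_pair scale A As \<and>
     (\<forall>i\<le>d. primitive_idempotent scale A (range (E i)) (E i)) \<and>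
     (\<forall>i\<le>d. primitive_idempotent scale As (range (Es i)) (Es i)) \<and>
     standard_ordering scale A As d (\<lambda>i. range (E i)) \<and>
     standard_ordering scale As A d (\<lambda>i. range (Es i))"

definition eigenvalue_on ::
  "('k::field \<Rightarrow> 'v::ab_group_add \<Rightarrow> 'v) \<Rightarrow>
   ('v \<Rightarrow> 'v) \<Rightarrow> 'v set \<Rightarrow> 'k" where
  "eigenvalue_on scale A U = (THE t. \<forall>v\<in>U. A v = scale t v)"

definition q_Racah_type ::
  "('k::field \<Rightarrow> 'v::ab_group_add \<Rightarrow> 'v) \<Rightarrow>
   nat \<Rightarrow> ('v \<Rightarrow> 'v) \<Rightarrow> (nat \<Rightarrow> 'v \<Rightarrow> 'v) \<Rightarrow> ('v \<Rightarrow> 'v) \<Rightarrow> (nat \<Rightarrow> 'v \<Rightarrow> 'v) \<Rightarrow>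
   'k \<Rightarrow> 'k \<Rightarrow> 'k \<Rightarrow> bool" where
  "q_Racah_type scale d A E As Es q a b \<longleftrightarrow>
     q \<noteq> 0 \<and> a \<noteq> 0 \<and> b \<noteq> 0 \<and> q ^ 4 \<noteq> 1 \<and>
     (\<forall>i\<le>d. eigenvalue_on scale A (range (E i)) =
              a * q powi (int d - 2 * int i) + inverse a * q powi (2 * int i - int d)) \<and>
     (\<forall>i\<le>d. eigenvalue_on scale As (range (Es i)) =
              b * q powi (int d - 2 * int i) + inverse b * q powi (2 * int i - int d))"

definition split_U ::
  "nat \<Rightarrow> (nat \<Rightarrow> 'v \<Rightarrow> 'v::ab_group_add) \<Rightarrow> (nat \<Rightarrow> 'v \<Rightarrow> 'v) \<Rightarrow> nat \<Rightarrow> 'v set" where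
  "split_U d E Es i = (\<Sum>j\<in>{..i}. range (Es j)) \<inter> (\<Sum>j\<in>{i..d}. range (E j))"

definition split_U_Down ::
  "nat \<Rightarrow> (nat \<Rightarrow> 'v \<Rightarrow> 'v::ab_group_add) \<Rightarrow> (nat \<Rightarrow> 'v \<Rightarrow> 'v) \<Rightarrow> nat \<Rightarrow> 'v set" where
  "split_U_Down d E Es i = (\<Sum>j\<in>{..i}. range (Es j)) \<inter> (\<Sum>j\<in>{..d-i}. range (E j))"

text \<open>
  \<open>K\<close>, \<open>B\<close> and \<open>\<Delta>\<close> are described by their defining properties. Each of these determines the map
  uniquely: for a TD system the space is the direct sum of the \<open>split_U d E Es i\<close> and also of
  the \<open>split_U_Down d E Es i\<close>, and for each \<open>i\<close> the first \<open>i\<close> summands of either decomposition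
  have the same sum.
\<close>
definition is_K ::
  "('k::field \<Rightarrow> 'v::ab_group_add \<Rightarrow> 'v) \<Rightarrow>
   nat \<Rightarrow> (nat \<Rightarrow> 'v \<Rightarrow> 'v) \<Rightarrow> (nat \<Rightarrow> 'v \<Rightarrow> 'v) \<Rightarrow> 'k \<Rightarrow> ('v \<Rightarrow> 'v) \<Rightarrow> bool" where
  "is_K scale d E Es q K \<longleftrightarrow> Vector_Spaces.linear scale scale K \<and>
     (\<forall>i\<le>d. \<forall>u\<in>split_U d E Es i. K u = scale (q powi (int d - 2 * int i)) u)"

definition is_B ::
  "('k::field \<Rightarrow> 'v::ab_group_add \<Rightarrow> 'v) \<Rightarrow>
   nat \<Rightarrow> (nat \<Rightarrow> 'v \<Rightarrow> 'v) \<Rightarrow> (nat \<Rightarrow> 'v \<Rightarrow> 'v) \<Rightarrow> 'k \<Rightarrow> ('v \<Rightarrow> 'v) \<Rightarrow> bool" where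
  "is_B scale d E Es q B \<longleftrightarrow> Vector_Spaces.linear scale scale B \<and>
     (\<forall>i\<le>d. \<forall>u\<in>split_U_Down d E Es i. B u = scale (q powi (int d - 2 * int i)) u)"

definition is_Delta ::
  "('k::field \<Rightarrow> 'v::ab_group_add \<Rightarrow> 'v) \<Rightarrow>
   nat \<Rightarrow> (nat \<Rightarrow> 'v \<Rightarrow> 'v) \<Rightarrow> (nat \<Rightarrow> 'v \<Rightarrow> 'v) \<Rightarrow> ('v \<Rightarrow> 'v) \<Rightarrow> bool" where
  "is_Delta scale d E Es \<Delta> \<longleftrightarrow> Vector_Spaces.linear scale scale \<Delta> \<and>
     (\<forall>i\<le>d. \<Delta> ` split_U d E Es i \<subseteq> split_U_Down d E Es i) \<and>
     (\<forall>i\<le>d. (\<lambda>u. \<Delta> u - u) ` split_U d E Es i \<subseteq> (\<Sum>j<i. split_U d E Es j))"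

definition M_map ::
  "('k::field \<Rightarrow> 'v::ab_group_add \<Rightarrow> 'v) \<Rightarrow>
   'k \<Rightarrow> ('v \<Rightarrow> 'v) \<Rightarrow> ('v \<Rightarrow> 'v) \<Rightarrow> 'v \<Rightarrow> 'v" where
  "M_map scale a K B v = scale (inverse (a - inverse a)) (scale a (K v) - scale (inverse a) (B v))"

definition W_space ::
  "('k::field \<Rightarrow> 'v::ab_group_add \<Rightarrow> 'v) \<Rightarrow>
   nat \<Rightarrow> 'k \<Rightarrow> 'k \<Rightarrow> ('v \<Rightarrow> 'v) \<Rightarrow> ('v \<Rightarrow> 'v) \<Rightarrow> nat \<Rightarrow> 'v set" where
  "W_space scale d q a K B i = eigenspace scale (M_map scale a K B) (q powi (int d - 2 * int i))"

end

theory Submission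
  imports Defs
begin

text \<open>
  Put \<open>F\<^sub>i = E\<^sub>0\<^sup>*V + \<dots> + E\<^sub>i\<^sup>*V\<close>. Irreducibility shows that \<open>F\<^sub>i\<close> is both
  \<open>U\<^sub>0 + \<dots> + U\<^sub>i\<close> and \<open>U\<^sub>0\<^sup>\<Down> + \<dots> + U\<^sub>i\<^sup>\<Down>\<close>, so \<open>K\<close>, \<open>B\<close> and hence \<open>\<M>\<close> all act
  on \<open>F\<^sub>i / F\<^bsub>i-1\<^esub>\<close> as \<open>q\<^bsup>d-2i\<^esup>\<close>. As these scalars are distinct, \<open>F\<^sub>i = W\<^sub>0 + \<dots> + W\<^sub>i\<close>.
  Finally \<open>\<Delta> - I\<close> maps \<open>F\<^sub>i\<close> into \<open>F\<^bsub>i-1\<^esub>\<close>, and therefore so does \<open>\<Delta>\<^sup>-\<^sup>1 - I\<close>.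
\<close>

context vector_space
begin

section \<open>Elementwise sums of subspaces and linear maps on them\<close>

text \<open>Closure, containment and monotonicity of elementwise sums all reduce to facts about
  spans through this identity.\<close>

lemma set_sum_eq_span:
  assumes "finite J" "\<And>j. j \<in> J \<Longrightarrow> subspace (X j)"
  shows "(\<Sum>j\<in>J. X j) = span (\<Union>j\<in>J. X j)"
  using assms
proof (induction J rule: finite_induct)
  case empty
  then show ?case by (simp add: set_zero)
next
  case (insert j J)
  have "span (\<Union>k\<in>insert j J. X k) = span (X j \<union> (\<Union>k\<in>J. X k))" by simp
  also have "\<dots> = span (X j) + span (\<Union>k\<in>J. X k)"
    unfolding span_Un set_plus_def by blast
  finally show ?case using insert by (simp add: span_eq_iff[THEN iffD2])
qed

lemma subspace_set_sum:
  assumes "finite J" "\<And>j. j \<in> J \<Longrightarrow> subspace (X j)"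
  shows "subspace (\<Sum>j\<in>J. X j)"
  using set_sum_eq_span[OF assms] subspace_span by auto

lemma set_sum_subset:
  assumes "finite J" "\<And>j. j \<in> J \<Longrightarrow> subspace (X j)"
    and "subspace S" "\<And>j. j \<in> J \<Longrightarrow> X j \<subseteq> S"
  shows "(\<Sum>j\<in>J. X j) \<subseteq> S"
proof -
  have "(\<Sum>j\<in>J. X j) = span (\<Union>j\<in>J. X j)" using assms(1,2) by (rule set_sum_eq_span)
  then show ?thesis using assms(3,4) by (simp add: span_minimal UN_least)
qed

lemma subset_set_sum:
  assumes "finite J" "\<And>j. j \<in> J \<Longrightarrow> subspace (X j)" "j \<in> J"
  shows "X j \<subseteq> (\<Sum>j\<in>J. X j)"
proof -
  have "(\<Sum>j\<in>J. X j) = span (\<Union>j\<in>J. X j)" using assms(1,2) by (rule set_sum_eq_span)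
  then show ?thesis using assms(3) by (auto intro: span_base)
qed

lemma set_sum_mono_index:
  assumes "finite J" "\<And>j. j \<in> J \<Longrightarrow> subspace (X j)" "I \<subseteq> J"
  shows "(\<Sum>j\<in>I. X j) \<subseteq> (\<Sum>j\<in>J. X j)"
proof (rule set_sum_subset)
  show "finite I" using assms finite_subset by blast
qed (use assms subspace_set_sum[of J X, OF assms(1,2)] subset_set_sum[of J X, OF assms(1,2)] in auto)

text \<open>The preimage of a subspace is a subspace, so it contains a sum as soon as it contains
  each summand. Later invariance arguments therefore only treat a vector of a single
  summand.\<close>

lemma linear_image_set_sum:
  assumes "Vector_Spaces.linear scale scale f" "subspace T" "finite J"
    and "\<And>j. j \<in> J \<Longrightarrow> subspace (X j)" "\<And>j v. j \<in> J \<Longrightarrow> v \<in> X j \<Longrightarrow> f v \<in> T"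
    and "v \<in> (\<Sum>j\<in>J. X j)"
  shows "f v \<in> T"
proof -
  interpret f: Vector_Spaces.linear scale scale f by fact
  have "(\<Sum>j\<in>J. X j) \<subseteq> f -` T"
    using assms(3,4) f.subspace_vimage[OF assms(2)] by (rule set_sum_subset) (use assms(5) in auto)
  then show ?thesis using assms(6) by auto
qed

lemma linear_minus_scale:
  assumes "Vector_Spaces.linear scale scale f"
  shows "Vector_Spaces.linear scale scale (\<lambda>v. f v - scale t v)"
proof -
  interpret f: Vector_Spaces.linear scale scale f by fact
  show ?thesis
    by unfold_locales (simp_all add: f.add f.scale algebra_simps)
qed

section \<open>Eigenspaces and their eigenvalues\<close>

lemma subspace_eigenspace:
  assumes "Vector_Spaces.linear scale scale f"
  shows "subspace (eigenspace scale f t)"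
proof -
  interpret f: Vector_Spaces.linear scale scale f by fact
  show ?thesis unfolding eigenspace_def
    by (auto simp: subspace_def f.add f.scale f.zero algebra_simps)
qed

text \<open>A nonzero vector makes the definite description unique; on \<open>{0}\<close> every
  scalar would satisfy it.\<close>

lemma eigenvalue_on_eigenspace:
  assumes "eigenspace scale A t \<noteq> {0}" "Vector_Spaces.linear scale scale A"
  shows "eigenvalue_on scale A (eigenspace scale A t) = t"
proof -
  have "0 \<in> eigenspace scale A t" using subspace_eigenspace[OF assms(2)] subspace_0 by auto
  then obtain v where v: "v \<in> eigenspace scale A t" "v \<noteq> 0" using assms(1) by auto
  show ?thesis unfolding eigenvalue_on_def
  proof (rule the_equality)
    fix s assume "\<forall>v\<in>eigenspace scale A t. A v = scale s v"
    then have "scale s v = scale t v" using v by (auto simp: eigenspace_def)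
    then show "s = t" using v by simp
  qed (simp add: eigenspace_def)
qed

section \<open>Maps acting as distinct scalars on the quotients of a flag\<close>

text \<open>Descent from \<open>P (Suc d)\<close>, the whole space: for \<open>m > i\<close>,
  subtracting \<open>\<kappa> m\<close> from \<open>M\<close> multiplies \<open>v\<close> by the
  nonzero scalar \<open>\<kappa> i - \<kappa> m\<close> and also moves it from
  \<open>P (Suc m)\<close> into \<open>P m\<close>.\<close>

lemma flag_eigenspace_subset:
  assumes P: "\<And>n. subspace (P n)" "P (Suc d) = UNIV"
    and M: "\<And>n v. n \<le> d \<Longrightarrow> v \<in> P (Suc n) \<Longrightarrow> M v - scale (\<kappa> n) v \<in> P n"
    and inj: "inj_on \<kappa> {..d}" and i: "i \<le> d" and v: "v \<in> eigenspace scale M (\<kappa> i)"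
  shows "v \<in> P (Suc i)"
proof -
  have "Suc i \<le> Suc d" using i by simp
  then show ?thesis
  proof (induction rule: inc_induct)
    case base
    then show ?case using P by simp
  next
    case (step m)
    then have m: "m \<le> d" "i < m" by auto
    have "M v - scale (\<kappa> m) v = scale (\<kappa> i - \<kappa> m) v"
      using v by (simp add: eigenspace_def scale_left_diff_distrib)
    then have "scale (\<kappa> i - \<kappa> m) v \<in> P m" using M[OF m(1) step.IH] by simp
    moreover have "\<kappa> i - \<kappa> m \<noteq> 0" using inj m i by (auto simp: inj_on_def)
    ultimately show ?case
      using subspace_scale[OF P(1), of "scale (\<kappa> i - \<kappa> m) v" m "inverse (\<kappa> i - \<kappa> m)"] by simp
  qed
qed

text \<open>The inclusion from left to right goes by induction: \<open>M - \<kappa> n\<close> maps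
  the sum of the earlier eigenspaces onto itself, so any \<open>v\<close> in
  \<open>P (Suc n)\<close> can be corrected by some \<open>y\<close> of that sum to an eigenvector
  \<open>v - y\<close> for \<open>\<kappa> n\<close>.\<close>

lemma flag_eq_set_sum_eigenspaces:
  assumes lin: "Vector_Spaces.linear scale scale M"
    and P: "\<And>n. subspace (P n)" "P 0 = {0}" "P (Suc d) = UNIV" "\<And>m n. m \<le> n \<Longrightarrow> P m \<subseteq> P n"
    and M: "\<And>n v. n \<le> d \<Longrightarrow> v \<in> P (Suc n) \<Longrightarrow> M v - scale (\<kappa> n) v \<in> P n"
    and inj: "inj_on \<kappa> {..d}" and n: "n \<le> Suc d"
  shows "P n = (\<Sum>j<n. eigenspace scale M (\<kappa> j))"
proof
  note sub = subspace_eigenspace[OF lin]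
  have "eigenspace scale M (\<kappa> j) \<subseteq> P n" if "j < n" for j
  proof -
    have "eigenspace scale M (\<kappa> j) \<subseteq> P (Suc j)"
      using flag_eigenspace_subset[of P, OF P(1,3) M inj] that n by auto
    also have "\<dots> \<subseteq> P n" using P(4) that by simp
    finally show ?thesis .
  qed
  then show "(\<Sum>j<n. eigenspace scale M (\<kappa> j)) \<subseteq> P n"
    using P(1) sub by (intro set_sum_subset) auto
  interpret M: Vector_Spaces.linear scale scale M by fact
  show "P n \<subseteq> (\<Sum>j<n. eigenspace scale M (\<kappa> j))" using n
  proof (induction n)
    case 0
    then show ?case using P by (simp add: set_zero)
  next
    case (Suc n)
    let ?S = "\<lambda>n. \<Sum>j<n. eigenspace scale M (\<kappa> j)"
    have S: "subspace (?S n)" for n using sub by (intro subspace_set_sum) auto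
    \<comment> \<open>The image of \<open>?S n\<close> under \<open>M - \<kappa> n\<close>. It
      contains each earlier eigenspace, on which this map is a nonzero multiple of the
      identity.\<close>
    let ?T = "{x. \<exists>y\<in>?S n. M y - scale (\<kappa> n) y = x}"
    have T: "subspace ?T"
    proof -
      interpret f: Vector_Spaces.linear scale scale "\<lambda>y. M y - scale (\<kappa> n) y"
        by (rule linear_minus_scale[OF lin])
      have "?T = (\<lambda>y. M y - scale (\<kappa> n) y) ` ?S n" by auto
      then show ?thesis using f.subspace_image[OF S] by simp
    qed
    have ST: "?S n \<subseteq> ?T"
    proof (rule set_sum_subset)
      fix j assume "j \<in> {..<n}"
      then have j: "j < n" by simp
      then have ne: "\<kappa> j - \<kappa> n \<noteq> 0" using inj Suc.prems by (auto simp: inj_on_def)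
      show "eigenspace scale M (\<kappa> j) \<subseteq> ?T"
      proof
        fix w assume w: "w \<in> eigenspace scale M (\<kappa> j)"
        let ?y = "scale (inverse (\<kappa> j - \<kappa> n)) w"
        have yj: "?y \<in> eigenspace scale M (\<kappa> j)" using w sub subspace_scale by blast
        then have "?y \<in> ?S n"
          using subset_set_sum[of "{..<n}" "\<lambda>j. eigenspace scale M (\<kappa> j)" j] sub j by auto
        moreover have "M ?y - scale (\<kappa> n) ?y = scale (\<kappa> j - \<kappa> n) ?y"
          using yj by (simp add: eigenspace_def scale_left_diff_distrib del: scale_scale)
        ultimately have "scale (\<kappa> j - \<kappa> n) ?y \<in> ?T" by (metis (mono_tags, lifting) mem_Collect_eq)
        then show "w \<in> ?T" using ne by simp
      qed
    qed (use T sub in auto)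
    show ?case
    proof
      fix v assume "v \<in> P (Suc n)"
      then have "M v - scale (\<kappa> n) v \<in> ?S n" using M Suc by auto
      then obtain y where y: "y \<in> ?S n" "M y - scale (\<kappa> n) y = M v - scale (\<kappa> n) v"
        using ST by blast
      have "v - y \<in> eigenspace scale M (\<kappa> n)"
        using y(2) by (simp add: eigenspace_def M.diff scale_right_diff_distrib algebra_simps)
      then have "y + (v - y) \<in> ?S n + eigenspace scale M (\<kappa> n)" using y(1) by (intro set_plus_intro)
      then show "v \<in> ?S (Suc n)" by simp
    qed
  qed
qed

section \<open>Splitting a flag by irreducibility\<close>

text \<open>The index of \<open>P\<close> is shifted: \<open>P (Suc i)\<close> plays the role of \<open>F\<^sub>i\<close>. The sum of the \<open>P (Suc i) \<inter> Q (i + r)\<close> is invariant under both maps; irreducibility makes it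
  zero for \<open>r = 1\<close> and everything for \<open>r = 0\<close>.\<close>

lemma flag_split:
  assumes lin: "Vector_Spaces.linear scale scale A" "Vector_Spaces.linear scale scale As"
    and irr: "\<And>W. subspace W \<Longrightarrow> A ` W \<subseteq> W \<Longrightarrow> As ` W \<subseteq> W \<Longrightarrow> W = {0} \<or> W = UNIV"
    and P: "\<And>n. subspace (P n)" "P 0 = {0}" "\<And>m n. m \<le> n \<Longrightarrow> P m \<subseteq> P n" "P (Suc 0) \<noteq> {0}"
    and Q: "\<And>n. subspace (Q n)" "Q (Suc d) = {0}" "\<And>m n. m \<le> n \<Longrightarrow> Q n \<subseteq> Q m"
      "Q 0 = UNIV" "Q (Suc 0) \<noteq> UNIV"
    and AP: "\<And>n v. n < d \<Longrightarrow> v \<in> P (Suc n) \<Longrightarrow> A v \<in> P (Suc (Suc n))"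
    and AQ: "\<And>n v. n \<le> d \<Longrightarrow> v \<in> Q n \<Longrightarrow> A v - scale (\<theta> n) v \<in> Q (Suc n)"
    and AsP: "\<And>n v. n \<le> d \<Longrightarrow> v \<in> P (Suc n) \<Longrightarrow> As v - scale (\<theta>s n) v \<in> P n"
    and AsQ: "\<And>n v. n < d \<Longrightarrow> v \<in> Q (Suc n) \<Longrightarrow> As v \<in> Q n"
    and n: "n \<le> Suc d"
  shows "P n = (\<Sum>j<n. P (Suc j) \<inter> Q j)"
proof
  define Z where "Z r i = P (Suc i) \<inter> Q (i + r)" for r i
  have Z: "subspace (Z r i)" for r i unfolding Z_def using P(1) Q(1) subspace_inter by blast
  define W where "W r = (\<Sum>i\<in>{i. i + r \<le> d}. Z r i)" for r
  have fin: "finite {i. i + r \<le> d}" for r by (rule finite_subset[of _ "{..d}"]) auto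
  have W: "subspace (W r)" for r unfolding W_def using fin Z by (rule subspace_set_sum)
  have ZW: "Z r i \<subseteq> W r" if "i + r \<le> d" for r i
    unfolding W_def using fin Z that by (intro subset_set_sum) auto
  \<comment> \<open>On \<open>Z r i\<close> the map \<open>A - \<theta> (i + r)\<close> raises both
    indices, landing in \<open>Z r (Suc i)\<close>; at the top, \<open>i + r = d\<close>, it lands
    in \<open>Q (Suc d) = {0}\<close>.\<close>
  have AW: "A v \<in> W r" if "v \<in> W r" for v r
  proof (rule linear_image_set_sum[OF lin(1) W fin Z _ that[unfolded W_def]])
    fix i v assume i: "i \<in> {i. i + r \<le> d}" and v: "v \<in> Z r i"
    have "A v - scale (\<theta> (i + r)) v \<in> W r"
    proof (cases "i + r = d")
      case True
      then show ?thesis using v AQ[of "i + r" v] Q(2) subspace_0[OF W] by (auto simp: Z_def)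
    next
      case False
      then have i': "Suc i + r \<le> d" "i < d" using i by auto
      have "A v - scale (\<theta> (i + r)) v \<in> P (Suc (Suc i))"
        using v AP[OF i'(2)] P(3)[of "Suc i" "Suc (Suc i)"]
        by (intro subspace_diff subspace_scale P(1)) (auto simp: Z_def)
      moreover have "A v - scale (\<theta> (i + r)) v \<in> Q (Suc i + r)"
        using v AQ[of "i + r" v] i by (auto simp: Z_def)
      ultimately show ?thesis using ZW[OF i'(1)] by (auto simp: Z_def)
    qed
    moreover have "scale (\<theta> (i + r)) v \<in> W r" using v ZW i W subspace_scale by blast
    ultimately show "A v \<in> W r" using subspace_add[OF W] by fastforce
  qed
  \<comment> \<open>Dually, \<open>As - \<theta>s i\<close> lowers both indices, landing in
    \<open>Z r (i - 1)\<close>, and it vanishes on \<open>Z r 0\<close> because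
    \<open>P 0 = {0}\<close>.\<close>
  have AsW: "As v \<in> W r" if "v \<in> W r" for v r
  proof (rule linear_image_set_sum[OF lin(2) W fin Z _ that[unfolded W_def]])
    fix i v assume i: "i \<in> {i. i + r \<le> d}" and v: "v \<in> Z r i"
    have "As v - scale (\<theta>s i) v \<in> W r"
    proof (cases i)
      case 0
      then show ?thesis using v AsP[of i v] P(2) subspace_0[OF W] by (auto simp: Z_def)
    next
      case (Suc k)
      have "As v - scale (\<theta>s i) v \<in> Q (k + r)"
        using v AsQ[of "k + r" v] Suc i Q(3)[of "k + r" "Suc (k + r)"]
        by (intro subspace_diff subspace_scale Q(1)) (auto simp: Z_def)
      moreover have "As v - scale (\<theta>s i) v \<in> P (Suc k)"
        using v AsP[of i v] i Suc by (auto simp: Z_def)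
      ultimately show ?thesis using ZW[of k r] i Suc by (auto simp: Z_def)
    qed
    moreover have "scale (\<theta>s i) v \<in> W r" using v ZW i W subspace_scale by blast
    ultimately show "As v \<in> W r" using subspace_add[OF W] by fastforce
  qed
  have W01: "W r = {0} \<or> W r = UNIV" for r using irr[OF W] AW AsW by blast
  have "Z 1 i \<subseteq> Q 1" for i using Q(3)[of 1 "i + 1"] by (auto simp: Z_def)
  then have "W 1 \<subseteq> Q 1" unfolding W_def
    using fin[of 1] Z Q(1) by (intro set_sum_subset) auto
  then have W1: "W 1 = {0}" using W01[of 1] Q(5) by auto
  \<comment> \<open>For \<open>m > 0\<close> this intersection is the summand
    \<open>Z 1 (m - 1)\<close> of the zero space \<open>W 1\<close>.\<close>
  have PQ: "P m \<inter> Q m \<subseteq> {0}" if "m \<le> d" for m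
    using that ZW[of "m - 1" 1] W1 P(2) by (cases m) (auto simp: Z_def)
  have "W 0 \<noteq> {0}"
  proof
    assume "W 0 = {0}"
    then have "P (Suc 0) \<subseteq> {0}" using ZW[of 0 0] Q(4) by (simp add: Z_def)
    then show False using P(4) subspace_0[OF P(1)] by blast
  qed
  then have W0: "W 0 = UNIV" using W01 by auto
  have U: "subspace (P (Suc j) \<inter> Q j)" for j using Z[of 0 j] by (simp add: Z_def)
  have UP: "(\<Sum>j<m. P (Suc j) \<inter> Q j) \<subseteq> P m" for m
    using U P(1) P(3)[OF Suc_leI] by (intro set_sum_subset) blast+
  then show "(\<Sum>j<n. P (Suc j) \<inter> Q j) \<subseteq> P n" .
  \<comment> \<open>Downward induction from \<open>Suc d\<close>, where the right-hand side is
    \<open>W 0\<close>. Passing from \<open>Suc m\<close> to \<open>m\<close>, the component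
    \<open>u\<close> of \<open>v\<close> in the last summand equals \<open>v - s\<close>, so it lies
    in \<open>P m \<inter> Q m\<close> and vanishes.\<close>
  show "P n \<subseteq> (\<Sum>j<n. P (Suc j) \<inter> Q j)"
    using n
  proof (induction rule: inc_induct)
    case base
    have "{i. i + 0 \<le> d} = {..<Suc d}" by auto
    then show ?case using W0 by (simp add: W_def Z_def lessThan_Suc_atMost)
  next
    case (step m)
    show ?case
    proof
      fix v assume v: "v \<in> P m"
      then have "v \<in> (\<Sum>j<m. P (Suc j) \<inter> Q j) + P (Suc m) \<inter> Q m"
        using step.IH P(3)[of m "Suc m"] by (auto simp: add.commute)
      then obtain s u where su: "v = s + u" "s \<in> (\<Sum>j<m. P (Suc j) \<inter> Q j)" "u \<in> Q m"
        by (auto elim: set_plus_elim)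
      then have "v - s \<in> P m" using UP v subspace_diff[OF P(1)] by blast
      then have "u = 0" using PQ[of m] step su by auto
      then show "v \<in> (\<Sum>j<m. P (Suc j) \<inter> Q j)" using su by simp
    qed
  qed
qed

section \<open>Standard orderings and the split decompositions\<close>

text \<open>Reversal preserves adjacency of indices. It allows the second split decomposition to be
  treated as the first one for the reversed eigenspaces of \<open>A\<close>.\<close>

lemma standard_ordering_rev:
  assumes "standard_ordering scale A B d V"
  shows "standard_ordering scale A B d (\<lambda>i. V (d - i))"
proof -
  have bij: "bij_betw (\<lambda>i. d - i) {..d} {..d}"
    by (rule bij_betw_byWitness[of _ "\<lambda>i. d - i"]) auto
  have "B ` V (d - i) \<subseteq> (\<Sum>j\<in>{i-1..i+1} \<inter> {..d}. V (d - j))" if "i \<le> d" for i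
  proof -
    have "(\<Sum>j\<in>{i-1..i+1} \<inter> {..d}. V (d - j)) = (\<Sum>j\<in>{d-i-1..d-i+1} \<inter> {..d}. V j)"
      by (rule sum.reindex_bij_witness[of _ "\<lambda>j. d - j" "\<lambda>j. d - j"]) (use that in auto)
    moreover have "B ` V (d - i) \<subseteq> (\<Sum>j\<in>{d-i-1..d-i+1} \<inter> {..d}. V j)"
      using assms unfolding standard_ordering_def by (meson diff_le_self)
    ultimately show ?thesis by metis
  qed
  then show ?thesis
    using assms bij_betw_trans[OF bij, of V "eigenspaces scale A"]
    by (auto simp: standard_ordering_def comp_def)
qed

lemma standard_ordering_eigenspace:
  assumes "Vector_Spaces.linear scale scale A" "standard_ordering scale A B d V" "i \<le> d"
  shows "V i = eigenspace scale A (eigenvalue_on scale A (V i))" "V i \<noteq> {0}"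
proof -
  have "V i \<in> eigenspaces scale A" using assms by (auto simp: standard_ordering_def bij_betw_def)
  then obtain t where t: "V i = eigenspace scale A t" "V i \<noteq> {0}"
    unfolding eigenspaces_def by blast
  then show "V i = eigenspace scale A (eigenvalue_on scale A (V i))" "V i \<noteq> {0}"
    using eigenvalue_on_eigenspace[OF _ assms(1), of t] by metis+
qed

lemma standard_ordering_inj:
  assumes "Vector_Spaces.linear scale scale A" "standard_ordering scale A B d V"
  shows "inj_on (\<lambda>i. eigenvalue_on scale A (V i)) {..d}"
proof (rule inj_onI)
  fix i j assume ij: "i \<in> {..d}" "j \<in> {..d}"
    "eigenvalue_on scale A (V i) = eigenvalue_on scale A (V j)"
  then have "V i = V j" using standard_ordering_eigenspace(1)[OF assms] by (metis atMost_iff)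
  then show "i = j" using ij assms(2) by (auto simp: standard_ordering_def bij_betw_def inj_on_def)
qed

text \<open>Supplies the flags for \<open>flag_split\<close>: initial sums of \<open>X\<close> and
  final sums of \<open>Y\<close>. The eigenvalue equations give the triangular relations, and the
  tridiagonal relations bound the growth by one index. Keeping \<open>Y\<close> arbitrary covers
  both split decompositions.\<close>

lemma TD_split_flag:
  assumes lin: "Vector_Spaces.linear scale scale A" "Vector_Spaces.linear scale scale As"
    and diag: "diagonalizable scale A"
    and irr: "\<And>W. subspace W \<Longrightarrow> A ` W \<subseteq> W \<Longrightarrow> As ` W \<subseteq> W \<Longrightarrow> W = {0} \<or> W = UNIV"
    and Y: "standard_ordering scale A As d Y" and X: "standard_ordering scale As A d X"
    and n: "n \<le> Suc d"
  shows "(\<Sum>j<n. X j) = (\<Sum>i<n. (\<Sum>j\<in>{..i}. X j) \<inter> (\<Sum>j\<in>{i..d}. Y j))"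
proof -
  define \<theta> where "\<theta> i = eigenvalue_on scale A (Y i)" for i
  define \<theta>s where "\<theta>s i = eigenvalue_on scale As (X i)" for i
  have Yi: "Y i = eigenspace scale A (\<theta> i)" "Y i \<noteq> {0}" if "i \<le> d" for i
    using standard_ordering_eigenspace[OF lin(1) Y that] by (auto simp: \<theta>_def)
  have Xi: "X i = eigenspace scale As (\<theta>s i)" "X i \<noteq> {0}" if "i \<le> d" for i
    using standard_ordering_eigenspace[OF lin(2) X that] by (auto simp: \<theta>s_def)
  have Ys: "subspace (Y i)" if "i \<le> d" for i using Yi[OF that] subspace_eigenspace[OF lin(1)] by simp
  have Xs: "subspace (X i)" if "i \<le> d" for i using Xi[OF that] subspace_eigenspace[OF lin(2)] by simp
  have inj: "inj_on \<theta> {..d}" using standard_ordering_inj[OF lin(1) Y] by (simp add: \<theta>_def[abs_def])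
  \<comment> \<open>The cap \<open>j \<le> d\<close> makes \<open>P n\<close> a subspace for every
    \<open>n\<close>, since \<open>X j\<close> is controlled only up to \<open>d\<close>.\<close>
  define P where "P n = (\<Sum>j\<in>{j. j < n \<and> j \<le> d}. X j)" for n
  define Q where "Q n = (\<Sum>j\<in>{n..d}. Y j)" for n
  have P: "subspace (P n)" for n unfolding P_def using Xs by (intro subspace_set_sum) auto
  have Q: "subspace (Q n)" for n unfolding Q_def using Ys by (intro subspace_set_sum) auto
  have Pm: "P m \<subseteq> P n" if "m \<le> n" for m n
    unfolding P_def using Xs that by (intro set_sum_mono_index) auto
  have Qm: "Q n \<subseteq> Q m" if "m \<le> n" for m n
    unfolding Q_def using Ys that by (intro set_sum_mono_index) auto
  have XP: "X j \<subseteq> P n" if "j < n" "j \<le> d" for j n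
    unfolding P_def using that Xs by (intro subset_set_sum) auto
  have YQ: "Y j \<subseteq> Q n" if "n \<le> j" "j \<le> d" for j n
    unfolding Q_def using that Ys by (intro subset_set_sum) auto
  have Q0: "Q 0 = UNIV"
  proof -
    have "Q 0 = span (\<Union>j\<in>{..d}. Y j)"
      unfolding Q_def atLeast0AtMost using Ys by (intro set_sum_eq_span) auto
    moreover have "Y ` {..d} = eigenspaces scale A"
      using Y by (auto simp: standard_ordering_def bij_betw_def)
    ultimately show ?thesis using diag by (simp add: diagonalizable_def)
  qed
  have AQ: "A v - scale (\<theta> n) v \<in> Q (Suc n)" if "n \<le> d" "v \<in> Q n" for n v
  proof (rule linear_image_set_sum[OF linear_minus_scale[OF lin(1)] Q _ _ _ that(2)[unfolded Q_def]])
    fix j v assume j: "j \<in> {n..d}" and v: "v \<in> Y j"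
    have *: "A v - scale (\<theta> n) v = scale (\<theta> j - \<theta> n) v"
      using v Yi(1)[of j] j by (simp add: eigenspace_def scale_left_diff_distrib)
    show "A v - scale (\<theta> n) v \<in> Q (Suc n)"
    proof (cases "j = n")
      case True
      then show ?thesis using * subspace_0[OF Q] by simp
    next
      case False
      then show ?thesis using * subspace_scale[OF Q] YQ[of "Suc n" j] v j by auto
    qed
  qed (use Ys in auto)
  have AsP: "As v - scale (\<theta>s n) v \<in> P n" if "n \<le> d" "v \<in> P (Suc n)" for n v
  proof (rule linear_image_set_sum[OF linear_minus_scale[OF lin(2)] P _ _ _ that(2)[unfolded P_def]])
    fix j v assume j: "j \<in> {j. j < Suc n \<and> j \<le> d}" and v: "v \<in> X j"
    have *: "As v - scale (\<theta>s n) v = scale (\<theta>s j - \<theta>s n) v"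
      using v Xi(1)[of j] j by (simp add: eigenspace_def scale_left_diff_distrib)
    show "As v - scale (\<theta>s n) v \<in> P n"
    proof (cases "j = n")
      case True
      then show ?thesis using * subspace_0[OF P] by simp
    next
      case False
      then show ?thesis using * subspace_scale[OF P] XP[of j n] v j by auto
    qed
  qed (use Xs in auto)
  have AP: "A v \<in> P (Suc (Suc n))" if "n < d" "v \<in> P (Suc n)" for n v
  proof (rule linear_image_set_sum[OF lin(1) P _ _ _ that(2)[unfolded P_def]])
    fix j v assume j: "j \<in> {j. j < Suc n \<and> j \<le> d}" and v: "v \<in> X j"
    then have "A v \<in> (\<Sum>k\<in>{j-1..j+1} \<inter> {..d}. X k)"
      using X by (auto simp: standard_ordering_def)
    also have "\<dots> \<subseteq> P (Suc (Suc n))"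
      unfolding P_def using Xs j by (intro set_sum_mono_index) auto
    finally show "A v \<in> P (Suc (Suc n))" .
  qed (use Xs in auto)
  have AsQ: "As v \<in> Q n" if "n < d" "v \<in> Q (Suc n)" for n v
  proof (rule linear_image_set_sum[OF lin(2) Q _ _ _ that(2)[unfolded Q_def]])
    fix j v assume j: "j \<in> {Suc n..d}" and v: "v \<in> Y j"
    then have "As v \<in> (\<Sum>k\<in>{j-1..j+1} \<inter> {..d}. Y k)"
      using Y by (auto simp: standard_ordering_def)
    also have "\<dots> \<subseteq> Q n"
      unfolding Q_def using Ys j by (intro set_sum_mono_index) auto
    finally show "As v \<in> Q n" .
  qed (use Ys in auto)
  \<comment> \<open>Otherwise \<open>Y 0\<close> would lie in \<open>Q (Suc 0)\<close>. Applying
    \<open>A - \<theta> (Suc n)\<close> rescales \<open>Y 0\<close> by a nonzero factor and sends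
    \<open>Q (Suc n)\<close> into \<open>Q (Suc (Suc n))\<close>, so \<open>Y 0\<close> would sink
    into \<open>Q (Suc d) = {0}\<close>.\<close>
  have Q1: "Q (Suc 0) \<noteq> UNIV"
  proof
    assume Q1: "Q (Suc 0) = UNIV"
    have "Y 0 \<subseteq> Q (Suc n)" if "n \<le> d" for n
      using that
    proof (induction n)
      case (Suc n)
      show ?case
      proof
        fix v assume v: "v \<in> Y 0"
        have "A v - scale (\<theta> (Suc n)) v = scale (\<theta> 0 - \<theta> (Suc n)) v"
          using v Yi(1)[of 0] by (simp add: eigenspace_def scale_left_diff_distrib)
        then have "scale (\<theta> 0 - \<theta> (Suc n)) v \<in> Q (Suc (Suc n))"
          using AQ[of "Suc n" v] Suc v by auto
        moreover have "\<theta> 0 - \<theta> (Suc n) \<noteq> 0" using inj Suc.prems by (auto simp: inj_on_def)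
        ultimately show "v \<in> Q (Suc (Suc n))"
          using subspace_scale[OF Q, of "scale (\<theta> 0 - \<theta> (Suc n)) v" _
              "inverse (\<theta> 0 - \<theta> (Suc n))"] by simp
      qed
    qed (use Q1 in simp)
    from this[of d] have "Y 0 \<subseteq> {0}" by (simp add: Q_def set_zero)
    then show False using Yi(2)[of 0] subspace_0[OF Ys[of 0]] by auto
  qed
  have P1: "P (Suc 0) \<noteq> {0}"
  proof
    assume "P (Suc 0) = {0}"
    then show False using XP[of 0 "Suc 0"] Xi(2)[of 0] subspace_0[OF Xs[of 0]] by auto
  qed
  have "P n = (\<Sum>j<n. P (Suc j) \<inter> Q j)"
    by (rule flag_split[OF lin irr P _ Pm P1 Q _ Qm Q0 Q1 AP AQ AsP AsQ n])
      (auto simp: P_def Q_def set_zero)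
  moreover have "P m = (\<Sum>j<m. X j)" if "m \<le> Suc d" for m
    unfolding P_def using that by (intro sum.cong) auto
  ultimately show ?thesis using n unfolding Q_def
    by (simp add: lessThan_Suc_atMost)
qed

section \<open>Triangular and unipotent maps on a flag\<close>

text \<open>On \<open>U j\<close> the shifted map is multiplication by
  \<open>\<kappa> j - \<kappa> n\<close>: it kills \<open>U n\<close> and keeps the earlier summands
  inside \<open>P n\<close>. Both \<open>K\<close> and \<open>B\<close> are handled this way, with
  different summands but the same flag and scalars.\<close>

lemma flag_shift_linear:
  assumes lin: "Vector_Spaces.linear scale scale f"
    and U: "\<And>j. j \<le> d \<Longrightarrow> subspace (U j)"
    and flag: "\<And>n. n \<le> Suc d \<Longrightarrow> P n = (\<Sum>j<n. U j)"
    and f: "\<And>j v. j \<le> d \<Longrightarrow> v \<in> U j \<Longrightarrow> f v = scale (\<kappa> j) v"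
    and n: "n \<le> d" and v: "v \<in> P (Suc n)"
  shows "f v - scale (\<kappa> n) v \<in> P n"
proof -
  have Pn: "P n = (\<Sum>j<n. U j)" using flag n by simp
  have sub: "subspace (P n)" unfolding Pn using U n by (intro subspace_set_sum) auto
  have v': "v \<in> (\<Sum>j<Suc n. U j)" using v flag[of "Suc n"] n by simp
  show ?thesis
  proof (rule linear_image_set_sum[OF linear_minus_scale[OF lin] sub _ _ _ v'])
    fix j v assume j: "j \<in> {..<Suc n}" and v: "v \<in> U j"
    have *: "f v - scale (\<kappa> n) v = scale (\<kappa> j - \<kappa> n) v"
      using f[of j v] v j n by (simp add: scale_left_diff_distrib)
    show "f v - scale (\<kappa> n) v \<in> P n"
    proof (cases "j = n")
      case True
      then show ?thesis using * subspace_0[OF sub] by simp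
    next
      case False
      then have "U j \<subseteq> P n" unfolding Pn using j n U by (intro subset_set_sum) auto
      then show ?thesis using * v subspace_scale[OF sub] by auto
    qed
  qed (use U n in auto)
qed

text \<open>A kernel vector satisfies \<open>f v - v = - v\<close>, so it descends through the flag
  to \<open>P 0\<close>. For surjectivity, climb the flag: if \<open>f v - v = f u\<close>, then
  \<open>v = f (v - u)\<close>.\<close>

lemma flag_unipotent_bij:
  assumes lin: "Vector_Spaces.linear scale scale f"
    and P: "\<And>n. subspace (P n)" "P 0 = {0}" "P (Suc d) = UNIV"
    and f: "\<And>n v. n \<le> d \<Longrightarrow> v \<in> P (Suc n) \<Longrightarrow> f v - v \<in> P n"
  shows "bij f"
proof -
  interpret f: Vector_Spaces.linear scale scale f by fact
  have "v = 0" if v: "f v = 0" for v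
  proof -
    have "v \<in> P 0"
    proof (rule inc_induct[of 0 "Suc d"])
      fix n assume "n < Suc d" "v \<in> P (Suc n)"
      then show "v \<in> P n" using f[of n v] v subspace_neg[OF P(1), of "- v" n] by simp
    qed (use P in auto)
    then show ?thesis using P by simp
  qed
  then have "inj f" using f.inj_iff_eq_0 by blast
  moreover have "P n \<subseteq> range f" if "n \<le> Suc d" for n
    using that
  proof (induction n)
    case 0
    then show ?case using P f.zero by (metis empty_subsetI insert_subset rangeI)
  next
    case (Suc n)
    show ?case
    proof
      fix v assume "v \<in> P (Suc n)"
      then obtain u where "f v - v = f u" using f[of n v] Suc by auto
      then have "v = f (v - u)" by (simp add: f.diff algebra_simps)
      then show "v \<in> range f" by blast
    qed
  qed
  then have "surj f" using P(3) by blast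
  ultimately show ?thesis by (simp add: bij_def)
qed

text \<open>With \<open>u = inv f v\<close>, the claim is the hypothesis on \<open>f u - u\<close>
  up to sign, once \<open>u\<close> lies in \<open>P (Suc n)\<close>. This follows by descent from
  the whole space, as \<open>v\<close> and \<open>v - u\<close> stay in each \<open>P m\<close> on
  the way.\<close>

lemma flag_unipotent_inv:
  assumes lin: "Vector_Spaces.linear scale scale f"
    and P: "\<And>n. subspace (P n)" "P 0 = {0}" "P (Suc d) = UNIV" "\<And>m n. m \<le> n \<Longrightarrow> P m \<subseteq> P n"
    and f: "\<And>n v. n \<le> d \<Longrightarrow> v \<in> P (Suc n) \<Longrightarrow> f v - v \<in> P n"
    and n: "n \<le> d" and v: "v \<in> P (Suc n)"
  shows "inv f v - v \<in> P n"
proof -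
  have "surj f" using flag_unipotent_bij[OF lin P(1-3) f] by (simp add: bij_def)
  then have fu: "f (inv f v) = v" by (rule surj_f_inv_f)
  have "Suc n \<le> Suc d" using n by simp
  then have "inv f v \<in> P (Suc n)"
  proof (induction rule: inc_induct)
    case base
    then show ?case using P by simp
  next
    case (step m)
    then have "v - inv f v \<in> P m" using f[of m "inv f v"] fu by simp
    moreover have "v \<in> P m" using v P(4)[of "Suc n" m] step by auto
    ultimately show ?case using subspace_diff[OF P(1), of v m "v - inv f v"] by simp
  qed
  then have "v - inv f v \<in> P n" using f[OF n] fu by fastforce
  then show ?thesis using subspace_neg[OF P(1), of "v - inv f v" n] by simp
qed

section \<open>The map \<open>M_map\<close> as a combination of \<open>K\<close> and
  \<open>B\<close>\<close>

lemma linear_M_map: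
  assumes "Vector_Spaces.linear scale scale K" "Vector_Spaces.linear scale scale B"
  shows "Vector_Spaces.linear scale scale (M_map scale a K B)"
proof -
  interpret K: Vector_Spaces.linear scale scale K by fact
  interpret B: Vector_Spaces.linear scale scale B by fact
  show ?thesis
    by unfold_locales
      (simp_all add: M_map_def K.add B.add K.scale B.scale algebra_simps)
qed

text \<open>The coefficients of \<open>K\<close> and \<open>B\<close> in \<open>M_map\<close> add up
  to 1, so a scalar can be subtracted from both maps separately.\<close>

lemma M_map_minus_scale:
  assumes "a - inverse a \<noteq> 0"
  shows "M_map scale a K B v - scale t v =
    scale (inverse (a - inverse a)) (scale a (K v - scale t v) - scale (inverse a) (B v - scale t v))"
proof -
  have "scale t v = scale (inverse (a - inverse a)) (scale (a - inverse a) (scale t v))"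
    using assms by simp
  also have "\<dots> = scale (inverse (a - inverse a)) (scale a (scale t v) - scale (inverse a) (scale t v))"
    by (simp only: scale_left_diff_distrib)
  finally have t: "scale t v = \<dots>" .
  have "M_map scale a K B v - scale t v =
      scale (inverse (a - inverse a)) (scale a (K v) - scale (inverse a) (B v))
    - scale (inverse (a - inverse a)) (scale a (scale t v) - scale (inverse a) (scale t v))"
    by (subst t) (simp only: M_map_def)
  also have "\<dots> = scale (inverse (a - inverse a))
      (scale a (K v - scale t v) - scale (inverse a) (B v - scale t v))"
    unfolding scale_right_diff_distrib by (simp only: diff_diff_eq2 diff_add_eq algebra_simps)
  finally show ?thesis .
qed

end

section \<open>The flag of a TD system of q-Racah type\<close>

theorem lemma9p3:
  fixes scale :: "'k::alg_closed_field \<Rightarrow> 'v::ab_group_add \<Rightarrow> 'v"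
    and Basis :: "'v set"
    and d :: nat
    and A As :: "'v \<Rightarrow> 'v" and E Es :: "nat \<Rightarrow> 'v \<Rightarrow> 'v"
    and q a b :: 'k
    and K B \<Delta> :: "'v \<Rightarrow> 'v"
  assumes "finite_dimensional_vector_space scale Basis"
    and "vector_space.dim scale (UNIV :: 'v set) > 0"
    and "TD_system scale d A E As Es"
    and "d \<ge> 1"
    and "q_Racah_type scale d A E As Es q a b"
    and "is_K scale d E Es q K"
    and "is_B scale d E Es q B"
    and "is_Delta scale d E Es \<Delta>"
  shows "\<forall>i\<le>d.
     (\<lambda>v. \<Delta> v - v) ` W_space scale d q a K B i
       \<subseteq> (\<Sum>j<i. W_space scale d q a K B j) \<and>
     (\<lambda>v. inv \<Delta> v - v) ` W_space scale d q a K B i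
       \<subseteq> (\<Sum>j<i. W_space scale d q a K B j)"
proof -
  interpret finite_dimensional_vector_space scale Basis by fact
  define X where "X i = range (Es i)" for i
  define Y where "Y i = range (E i)" for i
  have TD: "Vector_Spaces.linear scale scale A" "Vector_Spaces.linear scale scale As"
    "diagonalizable scale A"
    and irr: "\<And>W. subspace W \<Longrightarrow> A ` W \<subseteq> W \<Longrightarrow> As ` W \<subseteq> W \<Longrightarrow> W = {0} \<or> W = UNIV"
    using assms(3) unfolding TD_system_def TD_pair_def by blast+
  have Y: "standard_ordering scale A As d Y" and X: "standard_ordering scale As A d X"
    using assms(3) by (auto simp: TD_system_def X_def[abs_def] Y_def[abs_def])
  have Ys: "subspace (Y i)" if "i \<le> d" for i
    using standard_ordering_eigenspace(1)[OF TD(1) Y that] subspace_eigenspace[OF TD(1)] by metis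
  have Xs: "subspace (X i)" if "i \<le> d" for i
    using standard_ordering_eigenspace(1)[OF TD(2) X that] subspace_eigenspace[OF TD(2)] by metis

  \<comment> \<open>\<open>P (Suc i)\<close> is the sum of the first \<open>i + 1\<close>
    eigenspaces of \<open>As\<close>. The \<open>min\<close> keeps \<open>P\<close> constant beyond
    \<open>Suc d\<close>, so that it is a monotone family of subspaces for all indices.\<close>
  define P where "P n = (\<Sum>j<min n (Suc d). X j)" for n
  define U where "U = split_U d E Es"
  define D where "D = split_U_Down d E Es"
  have P: "subspace (P n)" for n unfolding P_def using Xs by (intro subspace_set_sum) auto
  have P0: "P 0 = {0}" by (simp add: P_def set_zero)
  have Pm: "P m \<subseteq> P n" if "m \<le> n" for m n
    unfolding P_def using Xs that by (intro set_sum_mono_index) auto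
  have Us: "subspace (U j)" if "j \<le> d" for j
    unfolding U_def split_U_def using Xs Ys that unfolding X_def Y_def
    by (intro subspace_inter subspace_set_sum) auto
  have Ds: "subspace (D j)" if "j \<le> d" for j
    unfolding D_def split_U_Down_def using Xs Ys that unfolding X_def Y_def
    by (intro subspace_inter subspace_set_sum) auto
  have PU: "P n = (\<Sum>j<n. U j)" if "n \<le> Suc d" for n
    using TD_split_flag[OF TD irr Y X that] that
    by (simp add: P_def U_def split_U_def X_def Y_def min_absorb1)
  have PD: "P n = (\<Sum>j<n. D j)" if "n \<le> Suc d" for n
  proof -
    have "(\<Sum>j\<in>{i..d}. Y (d - j)) = (\<Sum>j\<in>{..d-i}. Y j)" if "i \<le> d" for i
      by (rule sum.reindex_bij_witness[of _ "\<lambda>j. d - j" "\<lambda>j. d - j"]) (use that in auto)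
    then have "D i = (\<Sum>j\<in>{..i}. X j) \<inter> (\<Sum>j\<in>{i..d}. Y (d - j))" if "i \<le> d" for i
      using that by (simp add: D_def split_U_Down_def X_def Y_def)
    moreover have "P n = (\<Sum>i<n. (\<Sum>j\<in>{..i}. X j) \<inter> (\<Sum>j\<in>{i..d}. Y (d - j)))"
      using TD_split_flag[OF TD irr standard_ordering_rev[OF Y] X that] that
      by (simp add: P_def min_absorb1)
    ultimately show ?thesis using that by simp
  qed

  define \<kappa> where "\<kappa> i = q powi (int d - 2 * int i)" for i
  have q: "q \<noteq> 0"
    and \<theta>: "\<And>i. i \<le> d \<Longrightarrow> eigenvalue_on scale A (Y i) = a * \<kappa> i + inverse a * inverse (\<kappa> i)"
    using assms(5) by (auto simp: q_Racah_type_def Y_def \<kappa>_def simp flip: power_int_minus)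
  note \<theta>inj = standard_ordering_inj[OF TD(1) Y]
  \<comment> \<open>The eigenvalue of \<open>A\<close> on \<open>Y i\<close> depends on
    \<open>i\<close> only through \<open>\<kappa> i\<close>, so distinct eigenvalues force distinct
    \<open>\<kappa> i\<close>.\<close>
  have inj: "inj_on \<kappa> {..d}"
    using \<theta>inj \<theta> by (auto simp: inj_on_def)
  \<comment> \<open>If \<open>a\<close> were its own inverse, then
    \<open>\<kappa> d = inverse (\<kappa> 0)\<close> would make the eigenvalues on
    \<open>Y 0\<close> and \<open>Y d\<close> coincide, although \<open>d \<ge> 1\<close>.\<close>
  have a: "a - inverse a \<noteq> 0"
  proof
    assume "a - inverse a = 0"
    then have "inverse a = a" by simp
    moreover have "\<kappa> d = inverse (\<kappa> 0)" by (simp add: \<kappa>_def power_int_minus)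
    ultimately have "eigenvalue_on scale A (Y 0) = eigenvalue_on scale A (Y d)"
      using \<theta>[of 0] \<theta>[of d] by simp
    then show False using \<theta>inj assms(4) by (auto simp: inj_on_def)
  qed

  have K: "Vector_Spaces.linear scale scale K" "\<And>j v. j \<le> d \<Longrightarrow> v \<in> U j \<Longrightarrow> K v = scale (\<kappa> j) v"
    using assms(6) by (auto simp: is_K_def U_def \<kappa>_def)
  have B: "Vector_Spaces.linear scale scale B" "\<And>j v. j \<le> d \<Longrightarrow> v \<in> D j \<Longrightarrow> B v = scale (\<kappa> j) v"
    using assms(7) by (auto simp: is_B_def D_def \<kappa>_def)
  have \<Delta>: "Vector_Spaces.linear scale scale \<Delta>"
    "\<And>j v. j \<le> d \<Longrightarrow> v \<in> U j \<Longrightarrow> \<Delta> v - v \<in> P j"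
    using assms(8) PU unfolding is_Delta_def U_def by (auto simp: image_subset_iff)
  define M where "M = M_map scale a K B"
  have M: "Vector_Spaces.linear scale scale M"
    unfolding M_def using K(1) B(1) by (rule linear_M_map)
  have MP: "M v - scale (\<kappa> n) v \<in> P n" if "n \<le> d" "v \<in> P (Suc n)" for n v
  proof -
    have "K v - scale (\<kappa> n) v \<in> P n"
      by (rule flag_shift_linear[of K d U P \<kappa>, OF K(1) Us PU K(2) that])
    moreover have "B v - scale (\<kappa> n) v \<in> P n"
      by (rule flag_shift_linear[of B d D P \<kappa>, OF B(1) Ds PD B(2) that])
    ultimately show ?thesis
      unfolding M_def M_map_minus_scale[OF a]
      by (rule subspace_scale[OF P subspace_diff[OF P subspace_scale[OF P] subspace_scale[OF P]]])
  qed
  have \<Delta>P: "\<Delta> v - v \<in> P n" if n: "n \<le> d" and v: "v \<in> P (Suc n)" for n v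
  proof -
    have v': "v \<in> (\<Sum>j<Suc n. U j)" using v PU[of "Suc n"] n by simp
    \<comment> \<open>Writing \<open>v\<close> as \<open>scale 1 v\<close> presents
      \<open>\<Delta> - I\<close> in the form known to be linear.\<close>
    have "\<Delta> v - scale 1 v \<in> P n"
    proof (rule linear_image_set_sum[OF linear_minus_scale[OF \<Delta>(1)] P _ _ _ v'])
      fix j v assume "j \<in> {..<Suc n}" "v \<in> U j"
      then show "\<Delta> v - scale 1 v \<in> P n" using \<Delta>(2)[of j v] Pm[of j n] n by auto
    qed (use Us n in auto)
    then show ?thesis by simp
  qed
  have Pd: "P (Suc d) = UNIV"
  proof -
    have "(\<Sum>j<Suc d. X j) = span (\<Union>j\<in>{..<Suc d}. X j)"
      using Xs by (intro set_sum_eq_span) auto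
    moreover have "X ` {..<Suc d} = eigenspaces scale As"
      using X by (auto simp: standard_ordering_def bij_betw_def lessThan_Suc_atMost)
    ultimately show ?thesis using assms(3)
      by (simp add: P_def TD_system_def TD_pair_def diagonalizable_def)
  qed
  have W: "W_space scale d q a K B j = eigenspace scale M (\<kappa> j)" for j
    by (simp add: W_space_def M_def \<kappa>_def)
  have PW: "P i = (\<Sum>j<i. W_space scale d q a K B j)" if "i \<le> Suc d" for i
    unfolding W by (rule flag_eq_set_sum_eigenspaces[OF M P P0 Pd Pm MP inj that])
  have WP: "v \<in> P (Suc i)" if "i \<le> d" "v \<in> W_space scale d q a K B i" for i v
    using flag_eigenspace_subset[of P, OF P Pd MP inj that(1)] that(2) by (simp add: W)
  have inv: "inv \<Delta> v - v \<in> P i" if "i \<le> d" "v \<in> P (Suc i)" for i v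
    using flag_unipotent_inv[of \<Delta> P, OF \<Delta>(1) P P0 Pd Pm \<Delta>P that] .
  show ?thesis
  proof (intro allI impI)
    fix i assume i: "i \<le> d"
    then have "P i = (\<Sum>j<i. W_space scale d q a K B j)" using PW by simp
    then show "(\<lambda>v. \<Delta> v - v) ` W_space scale d q a K B i
       \<subseteq> (\<Sum>j<i. W_space scale d q a K B j) \<and>
     (\<lambda>v. inv \<Delta> v - v) ` W_space scale d q a K B i
       \<subseteq> (\<Sum>j<i. W_space scale d q a K B j)"
      using WP[OF i] \<Delta>P[OF i] inv[OF i] by blast
  qed
qed

end
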